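(* Let $p$ be a prime and let $G$ and $H$ be finite $p$-groups. If $G/Z^{\wedge}(G)\cong H/Z^{\wedge}(H)$, then $d(G)=d(H)$. In particular, if $G$ and $H$ are exterior isoclinic, then $d(G)=d(H)$.
   Context: $d(G)$ denotes the minimal number of generators of $G$. Notation: ${}^g h=ghg^{-1}$ and $[g,h]=ghg^{-1}h^{-1}$. The nonabelian tensor square $G\otimes G$ (Brown–Loday) is the group generated by symbols $g\otimes h$ ($g,h\in G$) subject to $gg_1\otimes h=({}^g g_1\otimes {}^g h)(g\otimes h)$ and $g\otimes hh_1=(g\otimes h)({}^h g\otimes {}^h h_1)$ for all $g,g_1,h,h_1\in G$. The exterior square $G\wedge G$ is the quotient of $G\otimes G$ by the normal subgroup generated by all $g\otimes g$; the image of $g\otimes h$ is $g\wedge h$. The exterior center is $Z^{\wedge}(G)=\{g\in G: g\wedge h=1 \text{ in } G\wedge G\ \forall h\in G\}$, a normal subgroup of $G$. Groups $G$ and $H$ are exterior isoclinic if there exist isomorphisms $\alpha:G/Z^{\wedge}(G)\to H/Z^{\wedge}(H)$ and $\beta:[G,G]\to[H,H]$ such that whenever $\alpha(g_1Z^{\wedge}(G))=h_1Z^{\wedge}(H)$ and $\alpha(g_2Z^{\wedge}(G))=h_2Z^{\wedge}(H)$, one has $\beta([g_1,g_2])=[h_1,h_2]$.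
   Formalization: The formal statement additionally assumes that G and H are both trivial or both nontrivial; without this the claim fails for G cyclic of order p and H trivial, where both quotients are trivial but d(G)=1 and d(H)=0. *)

theory Defs
  imports "HOL-Computational_Algebra.Primes" "HOL-Algebra.Generated_Groups"
begin

text \<open>
  A word over \<open>X\<close> is a list of letters \<open>(b, x)\<close> with \<open>x \<in> X\<close>; \<open>(True, x)\<close> stands for the generator
  \<open>x\<close> and \<open>(False, x)\<close> for its formal inverse. A relation is a pair of words \<open>(u, v)\<close>, read \<open>u = v\<close>.
\<close>

type_synonym 'x gword = "(bool \<times> 'x) list"

definition gwords :: "'x set \<Rightarrow> 'x gword set" where
  "gwords X = lists (UNIV \<times> X)"

inductive_set pres_cong :: "'x set \<Rightarrow> ('x gword \<times> 'x gword) set \<Rightarrow> ('x gword \<times> 'x gword) set"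
  for X R where
  refl: "u \<in> gwords X \<Longrightarrow> (u, u) \<in> pres_cong X R"
| sym: "(u, v) \<in> pres_cong X R \<Longrightarrow> (v, u) \<in> pres_cong X R"
| trans: "(u, v) \<in> pres_cong X R \<Longrightarrow> (v, w) \<in> pres_cong X R \<Longrightarrow> (u, w) \<in> pres_cong X R"
| append: "(u, u') \<in> pres_cong X R \<Longrightarrow> (v, v') \<in> pres_cong X R \<Longrightarrow> (u @ v, u' @ v') \<in> pres_cong X R"
| cancel: "x \<in> X \<Longrightarrow> ([(b, x), (\<not> b, x)], []) \<in> pres_cong X R"
| relation: "(u, v) \<in> R \<Longrightarrow> u \<in> gwords X \<Longrightarrow> v \<in> gwords X \<Longrightarrow> (u, v) \<in> pres_cong X R"

definition pres_class :: "'x set \<Rightarrow> ('x gword \<times> 'x gword) set \<Rightarrow> 'x gword \<Rightarrow> 'x gword set" where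
  "pres_class X R u = pres_cong X R `` {u}"

definition presented_group :: "'x set \<Rightarrow> ('x gword \<times> 'x gword) set \<Rightarrow> 'x gword set monoid" where
  "presented_group X R =
     \<lparr>carrier = gwords X // pres_cong X R,
      mult = (\<lambda>A B. \<Union>u\<in>A. \<Union>v\<in>B. pres_class X R (u @ v)),
      one = pres_class X R []\<rparr>"

lemma pres_cong_gwords:
  "(u, v) \<in> pres_cong X R \<Longrightarrow> u \<in> gwords X \<and> v \<in> gwords X"
  by (induction rule: pres_cong.induct) (auto simp: gwords_def)

lemma equiv_pres_cong: "equiv (gwords X) (pres_cong X R)"
proof (rule equivI)
  show "pres_cong X R \<subseteq> gwords X \<times> gwords X"
    using pres_cong_gwords by auto
  show "refl_on (gwords X) (pres_cong X R)"
    by (auto intro: refl_onI pres_cong.refl)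
  show "Relation.sym (pres_cong X R)"
    by (auto intro: symI pres_cong.sym)
  show "Relation.trans (pres_cong X R)"
    by (auto intro: transI pres_cong.trans)
qed

lemma pres_class_eq_iff:
  "u \<in> gwords X \<Longrightarrow> v \<in> gwords X \<Longrightarrow>
     pres_class X R u = pres_class X R v \<longleftrightarrow> (u, v) \<in> pres_cong X R"
  unfolding pres_class_def by (rule eq_equiv_class_iff[OF equiv_pres_cong])

lemma carrier_presented_group:
  "carrier (presented_group X R) = pres_class X R ` gwords X"
  by (auto simp: presented_group_def quotient_def pres_class_def)

lemma one_presented_group: "\<one>\<^bsub>presented_group X R\<^esub> = pres_class X R []"
  by (simp add: presented_group_def)

lemma gwords_append [simp]: "u @ v \<in> gwords X \<longleftrightarrow> u \<in> gwords X \<and> v \<in> gwords X"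
  by (auto simp: gwords_def)

lemma gwords_Nil [simp]: "[] \<in> gwords X"
  by (simp add: gwords_def)

lemma mult_presented_group:
  assumes "u \<in> gwords X" "v \<in> gwords X"
  shows "pres_class X R u \<otimes>\<^bsub>presented_group X R\<^esub> pres_class X R v = pres_class X R (u @ v)"
proof -
  have "pres_class X R (u' @ v') = pres_class X R (u @ v)"
    if "u' \<in> pres_class X R u" "v' \<in> pres_class X R v" for u' v'
  proof -
    have "(u' @ v', u @ v) \<in> pres_cong X R"
      using that by (auto simp: pres_class_def intro: pres_cong.append pres_cong.sym)
    from this pres_cong_gwords[OF this] show ?thesis
      by (simp add: pres_class_eq_iff)
  qed
  then have "(\<Union>u'\<in>pres_class X R u. \<Union>v'\<in>pres_class X R v. pres_class X R (u' @ v')) =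
      (\<Union>u'\<in>pres_class X R u. \<Union>v'\<in>pres_class X R v. pres_class X R (u @ v))"
    by (intro SUP_cong HOL.refl)
  moreover have "u \<in> pres_class X R u" "v \<in> pres_class X R v"
    using assms by (auto simp: pres_class_def intro: pres_cong.refl)
  then have "pres_class X R u \<noteq> {}" "pres_class X R v \<noteq> {}"
    by auto
  ultimately show ?thesis
    by (simp add: presented_group_def)
qed

lemma pres_cong_left_inverse:
  assumes "u \<in> gwords X"
  shows "(rev (map (\<lambda>(b, x). (\<not> b, x)) u) @ u, []) \<in> pres_cong X R"
  using assms
proof (induction u)
  case Nil
  then show ?case by (simp add: pres_cong.refl)
next
  case (Cons a u)
  obtain b x where a: "a = (b, x)" by (cases a)
  let ?w = "rev (map (\<lambda>(b, x). (\<not> b, x)) u)"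
  from Cons.prems a have x: "x \<in> X" and u: "u \<in> gwords X" by (auto simp: gwords_def)
  have w: "?w \<in> gwords X" using u by (auto simp: gwords_def)
  have "([(\<not> b, x), (b, x)], []) \<in> pres_cong X R"
    using pres_cong.cancel[OF x, of "\<not> b"] by simp
  from pres_cong.append[OF pres_cong.append[OF pres_cong.refl[OF w] this] pres_cong.refl[OF u]]
  have "(?w @ [(\<not> b, x), (b, x)] @ u, ?w @ u) \<in> pres_cong X R" by simp
  with Cons.IH[OF u] a show ?case by (auto intro: pres_cong.trans)
qed

lemma group_presented_group: "group (presented_group X R)"
proof (rule groupI)
  fix A assume "A \<in> carrier (presented_group X R)"
  then obtain u where u: "u \<in> gwords X" "A = pres_class X R u"
    by (auto simp: carrier_presented_group)
  let ?w = "rev (map (\<lambda>(b, x). (\<not> b, x)) u)"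
  have w: "?w \<in> gwords X" using u by (auto simp: gwords_def)
  have "pres_class X R ?w \<otimes>\<^bsub>presented_group X R\<^esub> A = \<one>\<^bsub>presented_group X R\<^esub>"
    using u w pres_cong_left_inverse[of u X R]
    by (simp add: mult_presented_group one_presented_group pres_class_eq_iff)
  then show "\<exists>B\<in>carrier (presented_group X R).
      B \<otimes>\<^bsub>presented_group X R\<^esub> A = \<one>\<^bsub>presented_group X R\<^esub>"
    using w by (auto simp: carrier_presented_group)
qed (auto simp: carrier_presented_group one_presented_group mult_presented_group)

definition normal_closure_of :: "('a, 'm) monoid_scheme \<Rightarrow> 'a set \<Rightarrow> 'a set" where
  "normal_closure_of G S = \<Inter> {N. N \<lhd> G \<and> S \<subseteq> N}"

definition lconj :: "('a, 'm) monoid_scheme \<Rightarrow> 'a \<Rightarrow> 'a \<Rightarrow> 'a" where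
  "lconj G g h = g \<otimes>\<^bsub>G\<^esub> h \<otimes>\<^bsub>G\<^esub> inv\<^bsub>G\<^esub> g"

definition commutator :: "('a, 'm) monoid_scheme \<Rightarrow> 'a \<Rightarrow> 'a \<Rightarrow> 'a" where
  "commutator G g h = g \<otimes>\<^bsub>G\<^esub> h \<otimes>\<^bsub>G\<^esub> inv\<^bsub>G\<^esub> g \<otimes>\<^bsub>G\<^esub> inv\<^bsub>G\<^esub> h"

text \<open>The symbol \<open>g \<otimes> h\<close> is encoded as the pair \<open>(g, h)\<close>.\<close>

definition tensor_relations ::
    "('a, 'm) monoid_scheme \<Rightarrow> (('a \<times> 'a) gword \<times> ('a \<times> 'a) gword) set" where
  "tensor_relations G =
     {([(True, (g \<otimes>\<^bsub>G\<^esub> g1, h))], [(True, (lconj G g g1, lconj G g h)), (True, (g, h))]) | g g1 h.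
        g \<in> carrier G \<and> g1 \<in> carrier G \<and> h \<in> carrier G} \<union>
     {([(True, (g, h \<otimes>\<^bsub>G\<^esub> h1))], [(True, (g, h)), (True, (lconj G h g, lconj G h h1))]) | g h h1.
        g \<in> carrier G \<and> h \<in> carrier G \<and> h1 \<in> carrier G}"

definition tensor_square :: "('a, 'm) monoid_scheme \<Rightarrow> ('a \<times> 'a) gword set monoid" where
  "tensor_square G = presented_group (carrier G \<times> carrier G) (tensor_relations G)"

definition tensor :: "('a, 'm) monoid_scheme \<Rightarrow> 'a \<Rightarrow> 'a \<Rightarrow> ('a \<times> 'a) gword set" where
  "tensor G g h = pres_class (carrier G \<times> carrier G) (tensor_relations G) [(True, (g, h))]"

definition tensor_diagonal :: "('a, 'm) monoid_scheme \<Rightarrow> ('a \<times> 'a) gword set set" where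
  "tensor_diagonal G =
     normal_closure_of (tensor_square G) {tensor G g g | g. g \<in> carrier G}"

definition exterior_square :: "('a, 'm) monoid_scheme \<Rightarrow> ('a \<times> 'a) gword set set monoid" where
  "exterior_square G = tensor_square G Mod tensor_diagonal G"

definition wedge :: "('a, 'm) monoid_scheme \<Rightarrow> 'a \<Rightarrow> 'a \<Rightarrow> ('a \<times> 'a) gword set set" where
  "wedge G g h = tensor_diagonal G #>\<^bsub>tensor_square G\<^esub> tensor G g h"

definition exterior_center :: "('a, 'm) monoid_scheme \<Rightarrow> 'a set" where
  "exterior_center G =
     {g \<in> carrier G. \<forall>h \<in> carrier G. wedge G g h = \<one>\<^bsub>exterior_square G\<^esub>}"

text \<open>
  \<open>[G, G]\<close> is the library's \<open>derived G (carrier G)\<close>, whose generators are the elements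
  \<open>commutator G g h\<close>. Cosets are written \<open>Z #> g\<close> because the elements of \<open>G Mod Z\<close> are right cosets;
  since the exterior center is normal, they are the left cosets \<open>g Z\<close>.
\<close>

definition exterior_isoclinic ::
    "('a, 'm) monoid_scheme \<Rightarrow> ('b, 'n) monoid_scheme \<Rightarrow> bool" where
  "exterior_isoclinic G H \<longleftrightarrow>
     (\<exists>\<alpha> \<in> iso (G Mod exterior_center G) (H Mod exterior_center H).
      \<exists>\<beta> \<in> iso (G\<lparr>carrier := derived G (carrier G)\<rparr>) (H\<lparr>carrier := derived H (carrier H)\<rparr>).
        \<forall>g1 \<in> carrier G. \<forall>g2 \<in> carrier G. \<forall>h1 \<in> carrier H. \<forall>h2 \<in> carrier H.
          \<alpha> (exterior_center G #>\<^bsub>G\<^esub> g1) = exterior_center H #>\<^bsub>H\<^esub> h1 \<longrightarrow>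
          \<alpha> (exterior_center G #>\<^bsub>G\<^esub> g2) = exterior_center H #>\<^bsub>H\<^esub> h2 \<longrightarrow>
          \<beta> (commutator G g1 g2) = commutator H h1 h2)"

text \<open>
  Meaningful for finitely generated groups. The trivial group has \<open>min_generators G = 0\<close>, while a
  nontrivial cyclic group \<open>C\<close> has \<open>min_generators C = 1\<close> and \<open>exterior_center C = carrier C\<close>. So the
  quotient by the exterior center does not distinguish \<open>C\<close> from the trivial group.
\<close>

definition min_generators :: "('a, 'm) monoid_scheme \<Rightarrow> nat" where
  "min_generators G =
     (LEAST n. \<exists>S. S \<subseteq> carrier G \<and> finite S \<and> card S = n \<and> generate G S = carrier G)"

definition finite_p_group :: "nat \<Rightarrow> ('a, 'm) monoid_scheme \<Rightarrow> bool" where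
  "finite_p_group p G \<longleftrightarrow> group G \<and> finite (carrier G) \<and> (\<exists>n. order G = p ^ n)"

end

theory Submission
  imports Defs
    "HOL-Algebra.Group_Action"
    "HOL-Algebra.Elementary_Groups"
    "HOL-Algebra.Multiplicative_Group"
begin

text \<open>
  Let \<open>Z\<close> be the exterior center of a finite \<open>p\<close>-group \<open>G\<close>. The proof recovers \<open>d(G)\<close> from the
  quotient \<open>G / Z\<close>, together with the knowledge whether \<open>G\<close> is trivial: \<open>d(G) = max 1 (d(G / Z))\<close>
  for nontrivial \<open>G\<close> (lemma \<open>min_generators_mod_exterior_center\<close>). An exterior isoclinism
  supplies the isomorphism of the quotients.

  If \<open>G\<close> is cyclic, its exterior square is trivial and \<open>Z = G\<close> (\<open>exterior_center_cyclic\<close>), so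
  \<open>d(G / Z) = 0\<close>. If \<open>G\<close> is not cyclic, \<open>Z\<close> consists of elements that can be
  dropped from every generating set, and therefore \<open>d(G) = d(G / Z)\<close>. The reason
  (\<open>generate_lift_mod_exterior_center\<close>) is that two homomorphisms \<open>\<chi>\<close>, \<open>\<psi>\<close> from \<open>G\<close> to the additive
  group of the field with \<open>p\<close> elements define a homomorphism on the exterior square, sending
  \<open>g \<and> h\<close> to the determinant \<open>\<chi> g * \<psi> h - \<chi> h * \<psi> g\<close>. It must vanish for \<open>g\<close> in \<open>Z\<close>, whereas a \<open>g\<close> that some \<open>\<chi>\<close>
  does not kill can be paired with a nonzero \<open>\<psi>\<close> that kills \<open>g\<close>, giving a nonzero value.

  Two ingredients support this. A proper subgroup of a finite \<open>p\<close>-group is annihilated by a nonzero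
  homomorphism to this additive group (\<open>hom_to_prime_field_vanishing_on\<close>), because maximal
  subgroups are normal. And homomorphisms on the exterior square are given by maps of two arguments that
  respect its relations; this universal property also shows that \<open>Z\<close> is normal.
\<close>

section \<open>Homomorphisms from finite p-groups to the cyclic group of order p\<close>

lemma (in group) inv_mult_cancel_left:
  assumes "x \<in> carrier G" "z \<in> carrier G"
  shows "x \<otimes> (inv x \<otimes> z) = z" "inv x \<otimes> (x \<otimes> z) = z"
  using assms by (simp_all flip: m_assoc)

lemma (in group) finite_carrier_of_prime_power_order:
  assumes "prime p" "order G = p ^ n"
  shows "finite (carrier G)"
  using prime_gt_0_nat[OF assms(1)] assms(2)
  by (intro card_ge_0_finite) (simp add: order_def)

text \<open>
  Orbits of a \<open>p\<close>-group have \<open>p\<close>-power size, and the orbits of size one are exactly the fixed points;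
  without fixed points, \<open>p\<close> divides the size of every orbit.
\<close>

lemma (in group_action) prime_dvd_card_if_no_fixed_point:
  assumes p: "prime p" and ord: "order G = p ^ n" and fin: "finite E"
    and nofix: "\<And>x. x \<in> E \<Longrightarrow> \<exists>g \<in> carrier G. \<phi> g x \<noteq> x"
  shows "p dvd card E"
proof -
  have "p dvd (\<Sum>x\<in>orb. 1)" if orb: "orb \<in> orbits G E \<phi>" for orb
  proof -
    obtain x where x: "x \<in> E" "orb = orbit G \<phi> x"
      using orb by (auto simp: orbits_def)
    have "card orb dvd p ^ n"
      using orbit_stabilizer_theorem[OF x(1)] x(2) ord by (metis dvd_triv_left)
    then obtain k where k: "card orb = p ^ k"
      using p by (auto simp: divides_primepow_nat)
    obtain g where g: "g \<in> carrier G" "\<phi> g x \<noteq> x" using nofix[OF x(1)] by blast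
    have "x \<in> orb" "\<phi> g x \<in> orb" using x orbit_refl g by (auto simp: orbit_def)
    then have "card orb \<noteq> 1" using g(2) by (auto simp: card_1_singleton_iff)
    with k show ?thesis by (cases k) auto
  qed
  then have "p dvd (\<Sum>orb\<in>orbits G E \<phi>. \<Sum>x\<in>orb. 1)" by (rule dvd_sum)
  also have "\<dots> = card E" using disjoint_sum[OF fin, of "\<lambda>_. 1 :: nat"] by simp
  finally show ?thesis .
qed

text \<open>
  Translating cosets on the right by the inverse of \<open>k\<close> turns right translation into a left action.
\<close>

lemma (in group) right_coset_action:
  assumes M: "subgroup M G" and K: "subgroup K G" and E: "E \<subseteq> rcosets M"
    and stable: "\<And>X k. X \<in> E \<Longrightarrow> k \<in> K \<Longrightarrow> X #> k \<in> E"
  shows "group_action (G\<lparr>carrier := K\<rparr>) E (\<lambda>k. \<lambda>X\<in>E. X #> inv k)"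
proof -
  have sub: "X \<subseteq> carrier G" if "X \<in> E" for X
    using E that rcosets_part_G[OF M] by blast
  have Kc: "k \<in> carrier G" if "k \<in> K" for k by (rule subgroup.mem_carrier[OF K that])
  have Ki: "inv k \<in> K" if "k \<in> K" for k by (rule subgroup.m_inv_closed[OF K that])
  have canc: "X #> k #> inv k = X" "X #> inv k #> k = X" if "X \<in> E" "k \<in> K" for X k
    using sub[OF that(1)] Kc[OF that(2)] by (simp_all add: coset_mult_assoc coset_mult_one)
  have bij: "(\<lambda>X\<in>E. X #> inv k) \<in> Bij E" if k: "k \<in> K" for k
    unfolding Bij_def
  proof (intro IntI CollectI)
    show "bij_betw (\<lambda>X\<in>E. X #> inv k) E E"
      by (rule bij_betwI[where g = "\<lambda>X. X #> k"]) (auto simp: k Ki stable canc)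
  qed simp
  have "(\<lambda>k. \<lambda>X\<in>E. X #> inv k) \<in> hom (G\<lparr>carrier := K\<rparr>) (BijGroup E)"
  proof (rule homI, goal_cases)
    case (1 k) then show ?case by (simp add: BijGroup_def bij)
  next
    case (2 k l)
    then have kl: "k \<in> K" "l \<in> K" by simp_all
    have "X #> inv (k \<otimes> l) = X #> inv l #> inv k" if "X \<in> E" for X
      using sub[OF that] Kc kl by (simp add: inv_mult_group coset_mult_assoc)
    then have "(\<lambda>X\<in>E. X #> inv (k \<otimes> l)) = compose E (\<lambda>X\<in>E. X #> inv k) (\<lambda>X\<in>E. X #> inv l)"
      using kl by (intro ext) (simp add: compose_def stable Ki)
    then show ?case using kl by (simp add: BijGroup_def bij)
  qed
  then show ?thesis
    by (simp add: group_action_def group_hom_def group_hom_axioms_def subgroup_imp_group[OF K]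
        group_BijGroup)
qed

text \<open>
  Normalizers grow in \<open>p\<close>-groups. Let \<open>M\<close> act on its own right cosets by translation. The coset
  \<open>M x\<close> is fixed exactly if \<open>x\<close> conjugates \<open>M\<close> into itself, and \<open>M\<close> is one fixed coset. If
  it were the only one, the number of the others would be divisible by \<open>p\<close>, so the index of \<open>M\<close>
  would be congruent to 1 modulo \<open>p\<close>; but the index of a proper subgroup is divisible by \<open>p\<close>.
\<close>

lemma (in group) exists_normalizing_element:
  assumes p: "prime p" and ord: "order G = p ^ n" and M: "subgroup M G" and ne: "M \<noteq> carrier G"
  shows "\<exists>x \<in> carrier G - M. \<forall>a \<in> M. x \<otimes> a \<otimes> inv x \<in> M"
proof (rule ccontr)
  assume "\<not> ?thesis"
  then have no: "\<exists>a \<in> M. x \<otimes> a \<otimes> inv x \<notin> M" if "x \<in> carrier G" "x \<notin> M" for x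
    using that by blast
  have fin: "finite (carrier G)" by (rule finite_carrier_of_prime_power_order[OF p ord])
  have MG: "M \<subseteq> carrier G" by (rule subgroup.subset[OF M])
  interpret M: subgroup M G by (rule M)
  let ?R = "rcosets M" let ?E = "?R - {M}"
  have lag: "card ?R * card M = p ^ n" using lagrange[OF M] ord by simp
  have finR: "finite ?R" using fin by (simp add: RCOSETS_def)
  have cM: "card M dvd p ^ n" using lag by (metis dvd_triv_right)
  then obtain m where m: "card M = p ^ m" using p by (auto simp: divides_primepow_nat)
  have MR: "M \<in> ?R" using M.subgroup_in_rcosets by (simp add: is_group)
  have stable: "X #> k \<in> ?E" if X: "X \<in> ?E" and k: "k \<in> M" for X k
  proof -
    obtain g where g: "g \<in> carrier G" "X = M #> g" using X by (auto simp: RCOSETS_def)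
    have kc: "k \<in> carrier G" using k MG by blast
    have e: "X #> k = M #> (g \<otimes> k)" using g kc MG by (simp add: coset_mult_assoc)
    have "M #> (g \<otimes> k) \<noteq> M"
    proof
      assume "M #> (g \<otimes> k) = M"
      then have "g \<otimes> k \<in> M" using coset_join1[of M "g \<otimes> k"] M g kc by simp
      then have "(g \<otimes> k) \<otimes> inv k \<in> M" using k by blast
      then have "g \<in> M" using g kc by (simp add: m_assoc)
      then show False using X g coset_join2 M by simp
    qed
    then show ?thesis using e g kc by (auto simp: RCOSETS_def)
  qed
  interpret act: group_action "G\<lparr>carrier := M\<rparr>" ?E "\<lambda>k. \<lambda>X\<in>?E. X #> inv k"
    by (rule right_coset_action[OF M M]) (use stable in auto)
  have "p dvd card ?E"
  proof (rule act.prime_dvd_card_if_no_fixed_point[OF p])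
    show "order (G\<lparr>carrier := M\<rparr>) = p ^ m" by (simp add: order_def m)
    show "finite ?E" using finR by simp
    fix X assume X: "X \<in> ?E"
    then obtain g where g: "g \<in> carrier G" "X = M #> g" by (auto simp: RCOSETS_def)
    have "g \<notin> M" using X g coset_join2 M by auto
    then obtain a where a: "a \<in> M" "g \<otimes> a \<otimes> inv g \<notin> M" using no g by blast
    have ac: "a \<in> carrier G" using a MG by blast
    have "X #> a \<noteq> X"
    proof
      assume "X #> a = X"
      then have "M #> (g \<otimes> a) = M #> g" using g ac MG by (simp add: coset_mult_assoc)
      then have "g \<otimes> a \<in> M #> g" using rcos_self[OF _ M] g ac by (metis m_closed)
      then obtain b where "b \<in> M" "g \<otimes> a = b \<otimes> g" by (auto simp: r_coset_def)
      then have "g \<otimes> a \<otimes> inv g = b" using g ac MG by (metis inv_solve_right m_closed subsetD)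
      then show False using a \<open>b \<in> M\<close> by simp
    qed
    then show "\<exists>k\<in>carrier (G\<lparr>carrier := M\<rparr>). (\<lambda>X\<in>?E. X #> inv k) X \<noteq> X"
      using X a ac by (intro bexI[of _ "inv a"]) auto
  qed
  moreover have "card ?R = Suc (card ?E)" using MR finR by (metis card.remove)
  moreover have "p dvd card ?R"
  proof -
    have "card ?R dvd p ^ n" using lag by (metis dvd_triv_left)
    then obtain k where k: "card ?R = p ^ k" using p by (auto simp: divides_primepow_nat)
    have "card ?R \<noteq> 1"
    proof
      assume "card ?R = 1"
      then have "card M = card (carrier G)" using lag ord by (simp add: order_def)
      then show False using ne MG fin card_subset_eq by blast
    qed
    with k show ?thesis by (cases k) auto
  qed
  ultimately have "p dvd 1" by (metis dvd_add_right_iff plus_1_eq_Suc add.commute)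
  then show False using p by simp
qed

lemma (in group) maximal_subgroup_normal:
  assumes p: "prime p" and ord: "order G = p ^ n" and M: "subgroup M G" and ne: "M \<noteq> carrier G"
    and max: "\<And>K. subgroup K G \<Longrightarrow> M \<subset> K \<Longrightarrow> K = carrier G"
  shows "M \<lhd> G"
proof -
  have fin: "finite (carrier G)" by (rule finite_carrier_of_prime_power_order[OF p ord])
  have MG: "M \<subseteq> carrier G" by (rule subgroup.subset[OF M])
  have finM: "finite M" using MG fin finite_subset by blast
  let ?N = "{g \<in> carrier G. \<forall>a \<in> M. g \<otimes> a \<otimes> inv g \<in> M}"
  obtain x where x: "x \<in> carrier G" "x \<notin> M" "\<forall>a \<in> M. x \<otimes> a \<otimes> inv x \<in> M"
    using exists_normalizing_element[OF p ord M ne] by blast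
  have "subgroup ?N G"
  proof (rule subgroupI)
    show "?N \<noteq> {}" using MG by (auto intro!: exI[of _ \<one>])
    fix g assume g: "g \<in> ?N"
    \<comment> \<open>Finiteness turns conjugation into \<open>M\<close> into conjugation onto \<open>M\<close>, which is what
      closure under inverses needs.\<close>
    have "inj_on (\<lambda>a. g \<otimes> a \<otimes> inv g) M"
      using g MG by (auto simp: inj_on_def subset_iff)
    then have im: "(\<lambda>a. g \<otimes> a \<otimes> inv g) ` M = M"
      using g finM by (intro endo_inj_surj) auto
    have "inv g \<otimes> a \<otimes> inv (inv g) \<in> M" if "a \<in> M" for a
    proof -
      obtain b where b: "b \<in> M" "a = g \<otimes> b \<otimes> inv g" using im \<open>a \<in> M\<close> by blast
      moreover have "b \<in> carrier G" using b MG by blast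
      ultimately have "inv g \<otimes> a \<otimes> inv (inv g) = b" using g by (simp add: m_assoc inv_mult_cancel_left)
      with b show ?thesis by simp
    qed
    then show "inv g \<in> ?N" using g by simp
    fix h assume h: "h \<in> ?N"
    have "g \<otimes> h \<otimes> a \<otimes> inv (g \<otimes> h) \<in> M" if a: "a \<in> M" for a
    proof -
      have "g \<otimes> (h \<otimes> a \<otimes> inv h) \<otimes> inv g \<in> M" using g h a by blast
      moreover have "a \<in> carrier G" using a MG by blast
      ultimately show ?thesis using g h by (simp add: m_assoc inv_mult_group)
    qed
    then show "g \<otimes> h \<in> ?N" using g h by simp
  qed simp
  moreover have "M \<subseteq> ?N"
    using M MG by (auto simp: subgroup.m_closed subgroup.m_inv_closed)
  then have "M \<subset> ?N" using x by blast
  ultimately have "?N = carrier G" by (rule max)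
  then show ?thesis using M by (auto simp: normal_inv_iff)
qed

lemma (in group) exists_maximal_subgroup:
  assumes fin: "finite (carrier G)" and A: "subgroup A G" and ne: "A \<noteq> carrier G"
  obtains M where "subgroup M G" "A \<subseteq> M" "M \<noteq> carrier G"
    "\<And>K. subgroup K G \<Longrightarrow> M \<subset> K \<Longrightarrow> K = carrier G"
proof -
  define S where "S = {K. subgroup K G \<and> A \<subseteq> K \<and> K \<noteq> carrier G}"
  have "S \<subseteq> Pow (carrier G)" by (auto simp: S_def dest: subgroup.subset)
  then have "finite S" using fin finite_subset by blast
  moreover have "S \<noteq> {}" using A ne by (auto simp: S_def)
  ultimately obtain M where "M \<in> S" "\<And>K. K \<in> S \<Longrightarrow> M \<subseteq> K \<Longrightarrow> M = K"
    using finite_has_maximal[of S] by blast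
  then show thesis using that[of M] unfolding S_def by blast
qed

text \<open>
  A maximal subgroup \<open>M\<close> above \<open>A\<close> is normal, and for any \<open>x\<close> outside \<open>M\<close> maximality makes
  \<open>G / M\<close> cyclic, generated by the coset of \<open>x\<close>. The order of this coset is a nontrivial power of
  \<open>p\<close>, so exponents of it are well defined modulo \<open>p\<close>; reading off the exponent is the wanted
  homomorphism.
\<close>

lemma (in group) hom_to_prime_field_vanishing_on:
  assumes p: "prime p" and ord: "order G = p ^ n" and A: "subgroup A G" and ne: "A \<noteq> carrier G"
  obtains \<chi> where "\<chi> \<in> hom G (integer_mod_group p)" "\<And>a. a \<in> A \<Longrightarrow> \<chi> a = 0"
    "\<exists>g \<in> carrier G. \<chi> g \<noteq> 0"
proof -
  have fin: "finite (carrier G)" by (rule finite_carrier_of_prime_power_order[OF p ord])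
  obtain M where M: "subgroup M G" "A \<subseteq> M" "M \<noteq> carrier G"
    and max: "\<And>K. subgroup K G \<Longrightarrow> M \<subset> K \<Longrightarrow> K = carrier G"
    using exists_maximal_subgroup[OF fin A ne] by blast
  interpret N: normal M G by (rule maximal_subgroup_normal[OF p ord M(1,3) max])
  interpret Q: group "G Mod M" by (rule N.factorgroup_is_group)
  interpret q: group_hom G "G Mod M" "\<lambda>g. M #> g"
    by (simp add: group_hom_def group_hom_axioms_def N.r_coset_hom_Mod is_group Q.is_group)
  obtain x where x: "x \<in> carrier G" "x \<notin> M" using subgroup.subset[OF M(1)] M(3) by blast
  let ?t = "M #> x"
  have t: "?t \<in> carrier (G Mod M)" using x by (simp add: carrier_FactGroup)
  have xM: "insert x M \<subseteq> carrier G" using x subgroup.subset[OF M(1)] by blast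
  have "generate G (insert x M) = carrier G"
  proof (rule max[OF generate_is_subgroup[OF xM]])
    show "M \<subset> generate G (insert x M)" using x by (auto intro: generate.incl)
  qed
  then have "carrier (G Mod M) = generate (G Mod M) ((\<lambda>g. M #> g) ` insert x M)"
    using q.generate_img[OF xM] by (simp add: carrier_FactGroup)
  also have "\<dots> \<subseteq> generate (G Mod M) {?t}"
  proof (rule Q.generate_subgroup_incl[OF _ Q.generate_is_subgroup])
    show "(\<lambda>g. M #> g) ` insert x M \<subseteq> generate (G Mod M) {?t}"
      using coset_join2[OF _ M(1)] M(1) generate.one[of "G Mod M" "{?t}"]
      by (auto intro: generate.incl simp: subgroup.mem_carrier)
  qed (use t in auto)
  finally have cyc: "\<exists>i::int. M #> g = ?t [^]\<^bsub>G Mod M\<^esub> i" if "g \<in> carrier G" for g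
    using that by (auto simp: Q.generate_pow[OF t] carrier_FactGroup)
  define e where "e g = (SOME i::int. M #> g = ?t [^]\<^bsub>G Mod M\<^esub> i)" for g
  have e: "M #> g = ?t [^]\<^bsub>G Mod M\<^esub> e g" if "g \<in> carrier G" for g
    unfolding e_def using someI_ex[OF cyc[OF that]] .
  have "?t \<noteq> \<one>\<^bsub>G Mod M\<^esub>" using x coset_join1[OF _ x(1) M(1)] by auto
  then have "Q.ord ?t \<noteq> 1" using Q.ord_eq_1[OF t] by blast
  moreover have "card (rcosets M) dvd p ^ n" using lagrange[OF M(1)] ord by (metis dvd_triv_left)
  moreover have "finite (carrier (G Mod M))" using fin by (simp add: carrier_FactGroup)
  then have "Q.ord ?t dvd card (rcosets M)"
    using Q.ord_dvd_group_order[OF t] by (simp add: order_def FactGroup_def)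
  ultimately have pord: "p dvd Q.ord ?t"
    using p by (metis dvd_trans divides_primepow_nat dvd_power gr0I power_0)
  have cong: "i mod int p = j mod int p"
    if "?t [^]\<^bsub>G Mod M\<^esub> (i::int) = ?t [^]\<^bsub>G Mod M\<^esub> j" for i j
  proof -
    have "int (Q.ord ?t) dvd j - i" using that Q.int_pow_eq[OF t] by blast
    then have "int p dvd j - i" using pord by (meson dvd_trans of_nat_dvd_iff)
    then show ?thesis by (metis mod_eq_dvd_iff)
  qed
  let ?\<chi> = "\<lambda>g. e g mod int p"
  show thesis
  proof
    show "?\<chi> \<in> hom G (integer_mod_group p)"
    proof (rule homI)
      fix g h assume g: "g \<in> carrier G" and h: "h \<in> carrier G"
      show "?\<chi> g \<in> carrier (integer_mod_group p)"
        using p prime_gt_0_nat by (simp add: carrier_integer_mod_group)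
      have "?t [^]\<^bsub>G Mod M\<^esub> e (g \<otimes> h) = ?t [^]\<^bsub>G Mod M\<^esub> (e g + e h)"
        using q.hom_mult[OF g h] e g h by (metis Q.int_pow_mult m_closed t)
      from cong[OF this] show "?\<chi> (g \<otimes> h) = ?\<chi> g \<otimes>\<^bsub>integer_mod_group p\<^esub> ?\<chi> h"
        by (simp add: mod_add_eq)
    qed
    show "?\<chi> a = 0" if "a \<in> A" for a
    proof -
      have a: "a \<in> M" "a \<in> carrier G" using that M(2) subgroup.subset[OF M(1)] by auto
      then have "?t [^]\<^bsub>G Mod M\<^esub> e a = ?t [^]\<^bsub>G Mod M\<^esub> (0::int)"
        using e[OF a(2)] coset_join2[OF a(2) M(1) a(1)] by simp
      from cong[OF this] show ?thesis by simp
    qed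
    have "?t [^]\<^bsub>G Mod M\<^esub> e x = ?t [^]\<^bsub>G Mod M\<^esub> (1::int)"
      using e[OF x(1)] t by simp
    from cong[OF this] have "?\<chi> x = 1"
      using prime_gt_1_nat[OF p] by simp
    then show "\<exists>g \<in> carrier G. ?\<chi> g \<noteq> 0" using x by (intro bexI[of _ x]) auto
  qed
qed

section \<open>Homomorphisms from presented groups\<close>

fun word_value :: "('a, 'm) monoid_scheme \<Rightarrow> ('x \<Rightarrow> 'a) \<Rightarrow> 'x gword \<Rightarrow> 'a" where
  "word_value L \<phi> [] = \<one>\<^bsub>L\<^esub>"
| "word_value L \<phi> ((b, x) # u) =
     (if b then \<phi> x else inv\<^bsub>L\<^esub> \<phi> x) \<otimes>\<^bsub>L\<^esub> word_value L \<phi> u"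

lemma (in group) word_value_closed:
  assumes "\<phi> \<in> X \<rightarrow> carrier G" "u \<in> gwords X"
  shows "word_value G \<phi> u \<in> carrier G"
  using assms(2)
proof (induction u)
  case (Cons a u)
  obtain b x where "a = (b, x)" by (cases a)
  with Cons assms(1) show ?case by (auto simp: gwords_def)
qed simp

lemma (in group) word_value_append:
  assumes "\<phi> \<in> X \<rightarrow> carrier G" "u \<in> gwords X" "v \<in> gwords X"
  shows "word_value G \<phi> (u @ v) = word_value G \<phi> u \<otimes> word_value G \<phi> v"
  using assms(2)
proof (induction u)
  case Nil
  then show ?case using word_value_closed[OF assms(1,3)] by simp
next
  case (Cons a u)
  obtain b x where a: "a = (b, x)" by (cases a)
  with Cons.prems have x: "x \<in> X" "u \<in> gwords X" by (auto simp: gwords_def)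
  then have "\<phi> x \<in> carrier G" "word_value G \<phi> u \<in> carrier G" "word_value G \<phi> v \<in> carrier G"
    using assms(1) word_value_closed[OF assms(1)] assms(3) by auto
  with a Cons.IH[OF x(2)] show ?case by (simp add: m_assoc)
qed

lemma (in group) word_value_cong:
  assumes \<phi>: "\<phi> \<in> X \<rightarrow> carrier G"
    and rel: "\<And>u v. (u, v) \<in> R \<Longrightarrow> u \<in> gwords X \<Longrightarrow> v \<in> gwords X \<Longrightarrow>
      word_value G \<phi> u = word_value G \<phi> v"
    and uv: "(u, v) \<in> pres_cong X R"
  shows "word_value G \<phi> u = word_value G \<phi> v"
  using uv
proof (induction rule: pres_cong.induct)
  case (append u u' v v')
  then show ?case
    using word_value_append[OF \<phi>] pres_cong_gwords[OF append.hyps(1)]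
      pres_cong_gwords[OF append.hyps(2)] by simp
next
  case (cancel x b)
  then have "\<phi> x \<in> carrier G" using \<phi> by blast
  then show ?case by simp
qed (auto intro: rel)

text \<open>
  The words in one class have the same value, so the value of an arbitrary representative defines
  a homomorphism.
\<close>

lemma (in group) presented_group_universal:
  assumes \<phi>: "\<phi> \<in> X \<rightarrow> carrier G"
    and rel: "\<And>u v. (u, v) \<in> R \<Longrightarrow> u \<in> gwords X \<Longrightarrow> v \<in> gwords X \<Longrightarrow>
      word_value G \<phi> u = word_value G \<phi> v"
  obtains f where "f \<in> hom (presented_group X R) G"
    "\<And>x. x \<in> X \<Longrightarrow> f (pres_class X R [(True, x)]) = \<phi> x"
proof -
  let ?f = "\<lambda>A. word_value G \<phi> (SOME u. u \<in> A)"
  have f: "?f (pres_class X R u) = word_value G \<phi> u" if u: "u \<in> gwords X" for u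
  proof -
    have "u \<in> pres_class X R u"
      using u by (auto simp: pres_class_def intro: pres_cong.refl)
    then have "(SOME v. v \<in> pres_class X R u) \<in> pres_class X R u" by (rule someI)
    then have "(u, SOME v. v \<in> pres_class X R u) \<in> pres_cong X R" by (simp add: pres_class_def)
    from word_value_cong[OF \<phi> rel this] show ?thesis by simp
  qed
  show thesis
  proof
    show "?f \<in> hom (presented_group X R) G"
    proof (rule homI)
      fix A assume "A \<in> carrier (presented_group X R)"
      then obtain u where u: "u \<in> gwords X" "A = pres_class X R u"
        by (auto simp: carrier_presented_group)
      show "?f A \<in> carrier G"
        unfolding u(2) f[OF u(1)] by (rule word_value_closed[OF \<phi> u(1)])
      fix B assume "B \<in> carrier (presented_group X R)"
      then obtain v where v: "v \<in> gwords X" "B = pres_class X R v"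
        by (auto simp: carrier_presented_group)
      have uv: "u @ v \<in> gwords X" using u v by simp
      show "?f (A \<otimes>\<^bsub>presented_group X R\<^esub> B) = ?f A \<otimes> ?f B"
        unfolding u(2) v(2) mult_presented_group[OF u(1) v(1)] f[OF u(1)] f[OF v(1)] f[OF uv]
        by (rule word_value_append[OF \<phi> u(1) v(1)])
    qed
    fix x assume x: "x \<in> X"
    then have "[(True, x)] \<in> gwords X" by (simp add: gwords_def)
    from f[OF this] show "?f (pres_class X R [(True, x)]) = \<phi> x"
      using x \<phi> by (auto simp: Pi_iff)
  qed
qed

section \<open>Exterior pairings and the universal property of the exterior square\<close>

text \<open>
  An exterior pairing satisfies in \<open>L\<close> the defining relations of the exterior square, with \<open>\<phi> g h\<close>
  in the role of \<open>g \<and> h\<close>. So pairings with values in \<open>L\<close> correspond to homomorphisms from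
  the exterior square to \<open>L\<close>.
\<close>

definition exterior_pairing ::
    "('a, 'm) monoid_scheme \<Rightarrow> ('b, 'n) monoid_scheme \<Rightarrow> ('a \<Rightarrow> 'a \<Rightarrow> 'b) \<Rightarrow> bool" where
  "exterior_pairing G L \<phi> \<longleftrightarrow>
     (\<forall>g \<in> carrier G. \<forall>h \<in> carrier G. \<phi> g h \<in> carrier L) \<and>
     (\<forall>g \<in> carrier G. \<forall>g1 \<in> carrier G. \<forall>h \<in> carrier G.
        \<phi> (g \<otimes>\<^bsub>G\<^esub> g1) h = \<phi> (lconj G g g1) (lconj G g h) \<otimes>\<^bsub>L\<^esub> \<phi> g h) \<and>
     (\<forall>g \<in> carrier G. \<forall>h \<in> carrier G. \<forall>h1 \<in> carrier G.
        \<phi> g (h \<otimes>\<^bsub>G\<^esub> h1) = \<phi> g h \<otimes>\<^bsub>L\<^esub> \<phi> (lconj G h g) (lconj G h h1)) \<and>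
     (\<forall>g \<in> carrier G. \<phi> g g = \<one>\<^bsub>L\<^esub>)"

lemma exterior_pairingD:
  assumes "exterior_pairing G L \<phi>" "g \<in> carrier G" "h \<in> carrier G" "k \<in> carrier G"
  shows "\<phi> g h \<in> carrier L"
    and "\<phi> (g \<otimes>\<^bsub>G\<^esub> k) h = \<phi> (lconj G g k) (lconj G g h) \<otimes>\<^bsub>L\<^esub> \<phi> g h"
    and "\<phi> g (h \<otimes>\<^bsub>G\<^esub> k) = \<phi> g h \<otimes>\<^bsub>L\<^esub> \<phi> (lconj G h g) (lconj G h k)"
    and "\<phi> g g = \<one>\<^bsub>L\<^esub>"
proof -
  note P = assms(1)[unfolded exterior_pairing_def]
  show "\<phi> g h \<in> carrier L"
    by (rule P[THEN conjunct1, rule_format, OF assms(2,3)])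
  show "\<phi> (g \<otimes>\<^bsub>G\<^esub> k) h = \<phi> (lconj G g k) (lconj G g h) \<otimes>\<^bsub>L\<^esub> \<phi> g h"
    by (rule P[THEN conjunct2, THEN conjunct1, rule_format, OF assms(2,4,3)])
  show "\<phi> g (h \<otimes>\<^bsub>G\<^esub> k) = \<phi> g h \<otimes>\<^bsub>L\<^esub> \<phi> (lconj G h g) (lconj G h k)"
    by (rule P[THEN conjunct2, THEN conjunct2, THEN conjunct1, rule_format, OF assms(2-4)])
  show "\<phi> g g = \<one>\<^bsub>L\<^esub>"
    by (rule P[THEN conjunct2, THEN conjunct2, THEN conjunct2, rule_format, OF assms(2)])
qed

lemma (in group) lconj_closed [simp]:
  "x \<in> carrier G \<Longrightarrow> g \<in> carrier G \<Longrightarrow> lconj G x g \<in> carrier G"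
  by (simp add: lconj_def)

lemma (in group) lconj_mult:
  assumes "x \<in> carrier G" "g \<in> carrier G" "h \<in> carrier G"
  shows "lconj G x (g \<otimes> h) = lconj G x g \<otimes> lconj G x h"
  using assms by (simp add: lconj_def m_assoc inv_mult_cancel_left)

lemma (in group) lconj_lconj:
  assumes "x \<in> carrier G" "g \<in> carrier G" "h \<in> carrier G"
  shows "lconj G x (lconj G g h) = lconj G (lconj G x g) (lconj G x h)"
  using assms by (simp add: lconj_def m_assoc inv_mult_group inv_mult_cancel_left)

lemma (in group) lconj_inv_cancel:
  assumes "x \<in> carrier G" "h \<in> carrier G"
  shows "lconj G x (lconj G (inv x) h) = h"
  using assms by (simp add: lconj_def m_assoc inv_mult_cancel_left)

text \<open>
  Conjugation preserves the defining relations. Applied to the wedge itself, this gives the action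
  of the group on its exterior square without constructing any automorphism of it.
\<close>

lemma (in group) exterior_pairing_lconj:
  assumes \<phi>: "exterior_pairing G L \<phi>" and x: "x \<in> carrier G"
  shows "exterior_pairing G L (\<lambda>g h. \<phi> (lconj G x g) (lconj G x h))"
  unfolding exterior_pairing_def
proof (intro conjI ballI)
  fix g h k assume "g \<in> carrier G" "h \<in> carrier G" "k \<in> carrier G"
  then show "\<phi> (lconj G x (g \<otimes> h)) (lconj G x k) =
      \<phi> (lconj G x (lconj G g h)) (lconj G x (lconj G g k)) \<otimes>\<^bsub>L\<^esub> \<phi> (lconj G x g) (lconj G x k)"
    and "\<phi> (lconj G x g) (lconj G x (h \<otimes> k)) =
      \<phi> (lconj G x g) (lconj G x h) \<otimes>\<^bsub>L\<^esub> \<phi> (lconj G x (lconj G h g)) (lconj G x (lconj G h k))"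
    using exterior_pairingD(2)[OF \<phi>, of "lconj G x g" "lconj G x k" "lconj G x h"]
      exterior_pairingD(3)[OF \<phi>, of "lconj G x g" "lconj G x h" "lconj G x k"] x
    by (simp_all add: lconj_mult lconj_lconj[of x g] lconj_lconj[of x h])
qed (use exterior_pairingD(1,4)[OF \<phi>] x in simp_all)

lemma group_tensor_square: "group (tensor_square G)"
  by (simp add: tensor_square_def group_presented_group)

lemma tensor_closed:
  "g \<in> carrier G \<Longrightarrow> h \<in> carrier G \<Longrightarrow> tensor G g h \<in> carrier (tensor_square G)"
  by (auto simp: tensor_def tensor_square_def carrier_presented_group gwords_def)

lemma (in group) tensor_square_universal:
  assumes \<phi>: "exterior_pairing K G \<phi>"
  obtains f where "f \<in> hom (tensor_square K) G"
    "\<And>g h. g \<in> carrier K \<Longrightarrow> h \<in> carrier K \<Longrightarrow> f (tensor K g h) = \<phi> g h"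
proof -
  let ?X = "carrier K \<times> carrier K"
  note D = exterior_pairingD[OF \<phi>]
  have cl: "case_prod \<phi> \<in> ?X \<rightarrow> carrier G" using D(1) by auto
  have "word_value G (case_prod \<phi>) u = word_value G (case_prod \<phi>) v"
    if "(u, v) \<in> tensor_relations K" "u \<in> gwords ?X" "v \<in> gwords ?X" for u v
    using that D by (auto simp: tensor_relations_def gwords_def)
  then obtain f where "f \<in> hom (tensor_square K) G"
    "\<And>x. x \<in> ?X \<Longrightarrow> f (pres_class ?X (tensor_relations K) [(True, x)]) = case_prod \<phi> x"
    using presented_group_universal[OF cl, of "tensor_relations K"]
    unfolding tensor_square_def by blast
  then show thesis by (intro that[of f]) (simp_all add: tensor_def)
qed

lemma (in group) normal_closure_of_normal:
  assumes "S \<subseteq> carrier G"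
  shows "normal_closure_of G S \<lhd> G"
proof -
  let ?F = "{N. N \<lhd> G \<and> S \<subseteq> N}"
  have "carrier G \<lhd> G" by (simp add: normal_inv_iff subgroup_self)
  then have "?F \<noteq> {}" using assms by blast
  then have "subgroup (\<Inter> ?F) G"
    by (intro subgroups_Inter) (auto simp: normal_inv_iff)
  then show ?thesis
    unfolding normal_closure_of_def by (auto simp: normal_inv_iff)
qed

lemma tensor_diagonal_normal: "tensor_diagonal G \<lhd> tensor_square G"
  unfolding tensor_diagonal_def
  by (rule group.normal_closure_of_normal[OF group_tensor_square]) (auto intro: tensor_closed)

lemma group_exterior_square: "group (exterior_square G)"
  unfolding exterior_square_def by (rule normal.factorgroup_is_group[OF tensor_diagonal_normal])

lemma wedge_eq_one_iff:
  assumes "g \<in> carrier G" "h \<in> carrier G"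
  shows "wedge G g h = \<one>\<^bsub>exterior_square G\<^esub> \<longleftrightarrow> tensor G g h \<in> tensor_diagonal G"
proof -
  interpret T: group "tensor_square G" by (rule group_tensor_square)
  have D: "subgroup (tensor_diagonal G) (tensor_square G)"
    by (rule normal_imp_subgroup[OF tensor_diagonal_normal])
  show ?thesis
    unfolding wedge_def exterior_square_def one_FactGroup
    using T.coset_join1[OF _ tensor_closed[OF assms] D] T.coset_join2[OF tensor_closed[OF assms] D]
    by blast
qed

text \<open>
  The half of the universal property that detects nontrivial wedges. The homomorphism on the tensor
  square induced by \<open>\<phi>\<close> kills the diagonal, hence its normal closure.
\<close>

lemma (in group) exterior_pairing_eq_one:
  assumes \<phi>: "exterior_pairing K G \<phi>" and g: "g \<in> carrier K" and h: "h \<in> carrier K"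
    and w: "wedge K g h = \<one>\<^bsub>exterior_square K\<^esub>"
  shows "\<phi> g h = \<one>"
proof -
  obtain f where f: "f \<in> hom (tensor_square K) G"
    "\<And>g h. g \<in> carrier K \<Longrightarrow> h \<in> carrier K \<Longrightarrow> f (tensor K g h) = \<phi> g h"
    using tensor_square_universal[OF \<phi>] by blast
  interpret f: group_hom "tensor_square K" G f
    by (simp add: group_hom_def group_hom_axioms_def f group_tensor_square is_group)
  have "{tensor K g g | g. g \<in> carrier K} \<subseteq> kernel (tensor_square K) G f"
    using f(2) exterior_pairingD(4)[OF \<phi>] by (auto simp: kernel_def tensor_closed)
  then have "tensor_diagonal K \<subseteq> kernel (tensor_square K) G f"
    using f.normal_kernel unfolding tensor_diagonal_def normal_closure_of_def by blast
  then show ?thesis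
    using w f(2)[OF g h] by (auto simp: wedge_eq_one_iff[OF g h] kernel_def)
qed

lemma (in group) exterior_pairing_wedge: "exterior_pairing G (exterior_square G) (wedge G)"
proof -
  interpret N: normal "tensor_diagonal G" "tensor_square G" by (rule tensor_diagonal_normal)
  let ?X = "carrier G \<times> carrier G"
  have mult: "wedge G g h \<otimes>\<^bsub>exterior_square G\<^esub> wedge G g' h' =
      tensor_diagonal G #>\<^bsub>tensor_square G\<^esub> pres_class ?X (tensor_relations G) [(True, (g, h)), (True, (g', h'))]"
    if "g \<in> carrier G" "h \<in> carrier G" "g' \<in> carrier G" "h' \<in> carrier G" for g h g' h'
  proof -
    have "tensor G g h \<otimes>\<^bsub>tensor_square G\<^esub> tensor G g' h' =
        pres_class ?X (tensor_relations G) [(True, (g, h)), (True, (g', h'))]"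
      using that mult_presented_group[of "[(True, (g, h))]" ?X "[(True, (g', h'))]"]
      by (simp add: tensor_def tensor_square_def gwords_def)
    then show ?thesis
      using N.rcos_sum[OF tensor_closed tensor_closed] that
      by (simp add: wedge_def exterior_square_def)
  qed
  have rel: "pres_class ?X (tensor_relations G) u = pres_class ?X (tensor_relations G) v"
    if "(u, v) \<in> tensor_relations G" "u \<in> gwords ?X" "v \<in> gwords ?X" for u v
    using that by (simp add: pres_class_eq_iff pres_cong.relation)
  show ?thesis
    unfolding exterior_pairing_def
  proof (intro conjI ballI)
    fix g h k assume g: "g \<in> carrier G" and h: "h \<in> carrier G"
    show "wedge G g h \<in> carrier (exterior_square G)"
      using tensor_closed[OF g h] by (auto simp: wedge_def exterior_square_def carrier_FactGroup)
    assume k: "k \<in> carrier G"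
    have "([(True, (g \<otimes> h, k))], [(True, (lconj G g h, lconj G g k)), (True, (g, k))])
        \<in> tensor_relations G"
      using g h k by (auto simp: tensor_relations_def)
    from rel[OF this] show "wedge G (g \<otimes> h) k =
        wedge G (lconj G g h) (lconj G g k) \<otimes>\<^bsub>exterior_square G\<^esub> wedge G g k"
      using g h k by (simp add: mult) (simp add: wedge_def tensor_def gwords_def)
    have "([(True, (g, h \<otimes> k))], [(True, (g, h)), (True, (lconj G h g, lconj G h k))])
        \<in> tensor_relations G"
      using g h k by (auto simp: tensor_relations_def)
    from rel[OF this] show "wedge G g (h \<otimes> k) =
        wedge G g h \<otimes>\<^bsub>exterior_square G\<^esub> wedge G (lconj G h g) (lconj G h k)"
      using g h k by (simp add: mult) (simp add: wedge_def tensor_def gwords_def)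
  next
    fix g assume g: "g \<in> carrier G"
    then have "tensor G g g \<in> tensor_diagonal G"
      by (auto simp: tensor_diagonal_def normal_closure_of_def)
    with g show "wedge G g g = \<one>\<^bsub>exterior_square G\<^esub>" by (simp add: wedge_eq_one_iff)
  qed
qed

section \<open>The exterior center\<close>

lemma (in group) exterior_pairing_one:
  assumes \<phi>: "exterior_pairing K G \<phi>" and K: "group K" and g: "g \<in> carrier K"
  shows "\<phi> \<one>\<^bsub>K\<^esub> g = \<one>" "\<phi> g \<one>\<^bsub>K\<^esub> = \<one>"
proof -
  interpret K: group K by (rule K)
  have id: "lconj K \<one>\<^bsub>K\<^esub> x = x" if "x \<in> carrier K" for x using that by (simp add: lconj_def)
  note D = exterior_pairingD[OF \<phi>]
  have "\<phi> \<one>\<^bsub>K\<^esub> g = \<phi> \<one>\<^bsub>K\<^esub> g \<otimes> \<phi> \<one>\<^bsub>K\<^esub> g"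
    using D(2)[of "\<one>\<^bsub>K\<^esub>" g "\<one>\<^bsub>K\<^esub>"] g id by simp
  then show "\<phi> \<one>\<^bsub>K\<^esub> g = \<one>" using D(1)[of "\<one>\<^bsub>K\<^esub>" g] g by (metis K.one_closed r_cancel_one')
  have "\<phi> g \<one>\<^bsub>K\<^esub> = \<phi> g \<one>\<^bsub>K\<^esub> \<otimes> \<phi> g \<one>\<^bsub>K\<^esub>"
    using D(3)[of g "\<one>\<^bsub>K\<^esub>" "\<one>\<^bsub>K\<^esub>"] g id by simp
  then show "\<phi> g \<one>\<^bsub>K\<^esub> = \<one>" using D(1)[of g "\<one>\<^bsub>K\<^esub>"] g by (metis K.one_closed r_cancel_one')
qed

text \<open>
  Closure under conjugation comes first: if \<open>g \<and> h\<close> is trivial, then so is its value under the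
  conjugated pairing, that is, the wedge of the two conjugates. Products and inverses then follow from the
  defining relation for \<open>g k \<and> h\<close>, which involves conjugates.
\<close>

lemma (in group) exterior_center_normal: "exterior_center G \<lhd> G"
proof -
  let ?Z = "exterior_center G" and ?E = "exterior_square G"
  interpret E: group ?E by (rule group_exterior_square)
  note W = exterior_pairing_wedge
  note D = exterior_pairingD[OF W]
  have Z: "g \<in> carrier G" "h \<in> carrier G \<Longrightarrow> wedge G g h = \<one>\<^bsub>?E\<^esub>" if "g \<in> ?Z" for g h
    using that by (auto simp: exterior_center_def)
  have conj: "lconj G x g \<in> ?Z" if g: "g \<in> ?Z" and x: "x \<in> carrier G" for x g
    unfolding exterior_center_def
  proof (intro CollectI conjI ballI)
    show "lconj G x g \<in> carrier G" using g x Z by simp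
    fix h assume h: "h \<in> carrier G"
    let ?h = "lconj G (inv x) h"
    have "wedge G (lconj G x g) (lconj G x ?h) = \<one>\<^bsub>?E\<^esub>"
      using E.exterior_pairing_eq_one[OF exterior_pairing_lconj[OF W x] Z(1)[OF g] _ Z(2)[OF g]] h x
      by simp
    then show "wedge G (lconj G x g) h = \<one>\<^bsub>?E\<^esub>" by (simp add: lconj_inv_cancel h x)
  qed
  have "subgroup ?Z G"
  proof (rule subgroupI)
    show "?Z \<subseteq> carrier G" by (auto simp: exterior_center_def)
    show "?Z \<noteq> {}"
      using E.exterior_pairing_one(1)[OF W is_group] by (auto simp: exterior_center_def)
    fix g assume g: "g \<in> ?Z"
    show "inv g \<in> ?Z"
      unfolding exterior_center_def
    proof (intro CollectI conjI ballI)
      show "inv g \<in> carrier G" using Z(1)[OF g] by simp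
      fix h assume h: "h \<in> carrier G"
      let ?h = "lconj G (inv g) h"
      have "lconj G g (inv g) = inv g" using Z(1)[OF g] by (simp add: lconj_def)
      then have "wedge G (g \<otimes> inv g) ?h = wedge G (inv g) h \<otimes>\<^bsub>?E\<^esub> wedge G g ?h"
        using D(2)[of g ?h "inv g"] Z(1)[OF g] h by (simp add: lconj_inv_cancel)
      then show "wedge G (inv g) h = \<one>\<^bsub>?E\<^esub>"
        using Z[OF g] h E.exterior_pairing_one(1)[OF W is_group, of ?h] D(1)[of "inv g" h] by simp
    qed
    fix k assume k: "k \<in> ?Z"
    show "g \<otimes> k \<in> ?Z"
      unfolding exterior_center_def
    proof (intro CollectI conjI ballI)
      show "g \<otimes> k \<in> carrier G" using g k Z by simp
      fix h assume h: "h \<in> carrier G"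
      show "wedge G (g \<otimes> k) h = \<one>\<^bsub>?E\<^esub>"
        using D(2)[OF Z(1)[OF g] h Z(1)[OF k]] Z(2)[OF conj[OF k Z(1)[OF g]]] Z[OF g] h by simp
    qed
  qed
  then show ?thesis
    using conj by (auto simp: normal_inv_iff lconj_def)
qed

text \<open>
  A cyclic group is abelian, so there the relations say that the wedge is bilinear; since
  \<open>a \<and> a\<close> is trivial, so is \<open>a\<^sup>i \<and> a\<^sup>j\<close>.
\<close>

lemma (in group) exterior_center_cyclic:
  assumes a: "a \<in> carrier G" and cyc: "generate G {a} = carrier G"
  shows "exterior_center G = carrier G"
proof -
  let ?E = "exterior_square G"
  interpret E: group ?E by (rule group_exterior_square)
  note D = exterior_pairingD[OF exterior_pairing_wedge]
  have pow: "\<exists>k::int. g = a [^] k" if "g \<in> carrier G" for g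
    using that generate_pow[OF a] cyc by auto
  have id: "lconj G x g = g" if x: "x \<in> carrier G" and g: "g \<in> carrier G" for x g
  proof -
    obtain i :: int where i: "x = a [^] i" using pow[OF x] by blast
    obtain j :: int where j: "g = a [^] j" using pow[OF g] by blast
    have xg: "x \<otimes> g = g \<otimes> x"
      unfolding i j int_pow_mult[OF a, symmetric] by (simp only: add.commute)
    show ?thesis unfolding lconj_def xg using x g by (simp add: m_assoc)
  qed
  let ?C = "{h \<in> carrier G. wedge G a h = \<one>\<^bsub>?E\<^esub>}"
  have "subgroup ?C G"
  proof (rule subgroupI)
    show "?C \<noteq> {}" using a D(4) by blast
    fix h assume "h \<in> ?C"
    then have h: "h \<in> carrier G" and ah: "wedge G a h = \<one>\<^bsub>?E\<^esub>" by simp_all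
    have mult: "wedge G a (h \<otimes> k) = wedge G a k" if k: "k \<in> carrier G" for k
      using D(3)[OF a h k] D(1)[OF a k k] by (simp only: id[OF h a] id[OF h k] ah E.l_one)
    show "inv h \<in> ?C"
      using mult[of "inv h"] E.exterior_pairing_one(2)[OF exterior_pairing_wedge is_group a] h
      by simp
    fix k assume "k \<in> ?C"
    then show "h \<otimes> k \<in> ?C" using mult h by simp
  qed auto
  then have "generate G {a} \<subseteq> ?C"
    using a D(4) by (intro generate_subgroup_incl) auto
  then have "a \<in> exterior_center G" using a cyc by (auto simp: exterior_center_def)
  then have "generate G {a} \<subseteq> exterior_center G"
    using normal_imp_subgroup[OF exterior_center_normal] by (intro generate_subgroup_incl) auto
  then show ?thesis using cyc by (auto simp: exterior_center_def)
qed

section \<open>Determinant pairings\<close>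

lemma (in group) hom_lconj_abelian:
  assumes L: "comm_group L" and f: "f \<in> hom G L" and x: "x \<in> carrier G" and g: "g \<in> carrier G"
  shows "f (lconj G x g) = f g"
proof -
  interpret L: comm_group L by (rule L)
  interpret f: group_hom G L f
    by (simp add: group_hom_def group_hom_axioms_def f is_group L.is_group)
  have "f (lconj G x g) = f g \<otimes>\<^bsub>L\<^esub> f x \<otimes>\<^bsub>L\<^esub> inv\<^bsub>L\<^esub> f x"
    using x g by (simp add: lconj_def L.m_comm[of "f x" "f g"])
  then show ?thesis using x g by (simp add: L.m_assoc)
qed

text \<open>
  Conjugation is invisible in an abelian target, so the relations of a pairing reduce to
  bilinearity. The determinant of two homomorphisms is bilinear and alternating.
\<close>

lemma (in group) exterior_pairing_determinant:
  assumes p: "p > 0" and \<chi>: "\<chi> \<in> hom G (integer_mod_group p)"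
    and \<psi>: "\<psi> \<in> hom G (integer_mod_group p)"
  shows "exterior_pairing G (integer_mod_group p) (\<lambda>g h. (\<chi> g * \<psi> h - \<chi> h * \<psi> g) mod int p)"
proof -
  note conj = hom_lconj_abelian[OF abelian_integer_mod_group \<chi>]
    hom_lconj_abelian[OF abelian_integer_mod_group \<psi>]
  have add: "\<chi> (g \<otimes> h) = (\<chi> g + \<chi> h) mod int p" "\<psi> (g \<otimes> h) = (\<psi> g + \<psi> h) mod int p"
    if "g \<in> carrier G" "h \<in> carrier G" for g h
    using hom_mult[OF \<chi> that] hom_mult[OF \<psi> that] by simp_all
  have left: "((a + b) mod m * c - d * ((e + f) mod m)) mod m =
      ((b * c - d * f) mod m + (a * c - d * e) mod m) mod m" for a b c d e f m :: int
  proof -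
    have "((a + b) mod m * c - d * ((e + f) mod m)) mod m = ((a + b) * c - d * (e + f)) mod m"
      by (intro mod_diff_cong mod_mult_cong) simp_all
    also have "(a + b) * c - d * (e + f) = (b * c - d * f) + (a * c - d * e)"
      by (simp add: algebra_simps)
    finally show ?thesis by (simp add: mod_add_eq)
  qed
  have right: "(c * ((e + f) mod m) - ((a + b) mod m) * d) mod m =
      ((c * e - a * d) mod m + (c * f - b * d) mod m) mod m" for a b c d e f m :: int
  proof -
    have "(c * ((e + f) mod m) - ((a + b) mod m) * d) mod m = (c * (e + f) - (a + b) * d) mod m"
      by (intro mod_diff_cong mod_mult_cong) simp_all
    also have "c * (e + f) - (a + b) * d = (c * e - a * d) + (c * f - b * d)"
      by (simp add: algebra_simps)
    finally show ?thesis by (simp add: mod_add_eq)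
  qed
  show ?thesis
    unfolding exterior_pairing_def
  proof (intro conjI ballI)
    fix g h k assume g: "g \<in> carrier G" and h: "h \<in> carrier G"
    show "(\<chi> g * \<psi> h - \<chi> h * \<psi> g) mod int p \<in> carrier (integer_mod_group p)"
      using p by (simp add: carrier_integer_mod_group)
    assume k: "k \<in> carrier G"
    show "(\<chi> (g \<otimes> h) * \<psi> k - \<chi> k * \<psi> (g \<otimes> h)) mod int p =
        (\<chi> (lconj G g h) * \<psi> (lconj G g k) - \<chi> (lconj G g k) * \<psi> (lconj G g h)) mod int p
          \<otimes>\<^bsub>integer_mod_group p\<^esub> ((\<chi> g * \<psi> k - \<chi> k * \<psi> g) mod int p)"
      unfolding conj[OF g h] conj[OF g k] add[OF g h] mult_integer_mod_group by (rule left)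
    show "(\<chi> g * \<psi> (h \<otimes> k) - \<chi> (h \<otimes> k) * \<psi> g) mod int p =
        (\<chi> g * \<psi> h - \<chi> h * \<psi> g) mod int p \<otimes>\<^bsub>integer_mod_group p\<^esub>
        ((\<chi> (lconj G h g) * \<psi> (lconj G h k) - \<chi> (lconj G h k) * \<psi> (lconj G h g)) mod int p)"
      unfolding conj[OF h g] conj[OF h k] add[OF h k] mult_integer_mod_group by (rule right)
  qed simp
qed

text \<open>
  If \<open>S\<close> generated a proper subgroup, some nonzero \<open>\<chi>\<close> would vanish on it, and since \<open>S\<close> generates
  modulo the exterior center, \<open>\<chi> z\<close> would be nonzero for some \<open>z\<close> in the exterior center. As the
  group is not cyclic, some nonzero \<open>\<psi>\<close> vanishes at \<open>z\<close>. The determinant pairing of \<open>\<chi>\<close> and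
  \<open>\<psi>\<close> then sends \<open>(z, h)\<close> to \<open>\<chi> z * \<psi> h\<close>, which is nonzero for suitable \<open>h\<close> although
  \<open>z \<and> h\<close> is trivial. Thus the exterior center of a noncyclic \<open>p\<close>-group lies in the Frattini
  subgroup.
\<close>

lemma (in group) generate_lift_mod_exterior_center:
  assumes p: "prime p" and ord: "order G = p ^ n"
    and noncyc: "\<And>a. a \<in> carrier G \<Longrightarrow> generate G {a} \<noteq> carrier G"
    and S: "S \<subseteq> carrier G"
    and gen: "generate (G Mod exterior_center G) ((#>) (exterior_center G) ` S) =
      carrier (G Mod exterior_center G)"
  shows "generate G S = carrier G"
proof (rule ccontr)
  let ?Z = "exterior_center G" and ?P = "integer_mod_group p"
  interpret Z: normal ?Z G by (rule exterior_center_normal)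
  interpret Q: group "G Mod ?Z" by (rule Z.factorgroup_is_group)
  interpret q: group_hom G "G Mod ?Z" "(#>) ?Z"
    by (simp add: group_hom_def group_hom_axioms_def Z.r_coset_hom_Mod is_group Q.is_group)
  have P: "group ?P" by simp
  assume "generate G S \<noteq> carrier G"
  then obtain \<chi> where \<chi>: "\<chi> \<in> hom G ?P" "\<And>a. a \<in> generate G S \<Longrightarrow> \<chi> a = 0"
      "\<exists>g \<in> carrier G. \<chi> g \<noteq> 0"
    using hom_to_prime_field_vanishing_on[OF p ord generate_is_subgroup[OF S]] by blast
  have "\<exists>z \<in> ?Z. \<chi> z \<noteq> 0"
  proof (rule ccontr)
    assume "\<not> ?thesis"
    then have Z0: "\<chi> z = 0" if "z \<in> ?Z" for z using that by blast
    have "\<chi> g = 0" if g: "g \<in> carrier G" for g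
    proof -
      have "?Z #> g \<in> (#>) ?Z ` generate G S"
        using g gen q.generate_img[OF S] by (auto simp: carrier_FactGroup)
      then obtain a where a: "a \<in> generate G S" "?Z #> g = ?Z #> a" by blast
      have ac: "a \<in> carrier G" using a(1) generate_in_carrier[OF S] by blast
      have "g \<in> ?Z #> a" using rcos_self[OF g Z.subgroup_axioms] a by simp
      then obtain z where "z \<in> ?Z" "g = z \<otimes> a" by (auto simp: r_coset_def)
      then show "\<chi> g = 0" using hom_mult[OF \<chi>(1), of z a] Z0 \<chi>(2)[OF a(1)] ac Z.mem_carrier by simp
    qed
    then show False using \<chi>(3) by blast
  qed
  then obtain z where z: "z \<in> ?Z" "\<chi> z \<noteq> 0" by blast
  have zc: "z \<in> carrier G" using z Z.mem_carrier by blast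
  obtain \<psi> where \<psi>: "\<psi> \<in> hom G ?P" "\<And>a. a \<in> generate G {z} \<Longrightarrow> \<psi> a = 0"
      "\<exists>g \<in> carrier G. \<psi> g \<noteq> 0"
    using hom_to_prime_field_vanishing_on[OF p ord generate_is_subgroup noncyc] zc by auto
  then obtain h where h: "h \<in> carrier G" "\<psi> h \<noteq> 0" by blast
  have "wedge G z h = \<one>\<^bsub>exterior_square G\<^esub>"
    using z(1) h(1) unfolding exterior_center_def by blast
  then have "(\<chi> z * \<psi> h - \<chi> h * \<psi> z) mod int p = \<one>\<^bsub>?P\<^esub>"
    by (rule group.exterior_pairing_eq_one[OF P
          exterior_pairing_determinant[OF prime_gt_0_nat[OF p] \<chi>(1) \<psi>(1)] zc h(1)])
  moreover have "\<psi> z = 0" by (rule \<psi>(2)) (auto intro: generate.incl)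
  ultimately have "int p dvd \<chi> z * \<psi> h" by (simp add: mod_eq_0_iff_dvd)
  then have "int p dvd \<chi> z \<or> int p dvd \<psi> h" using p by (simp add: prime_dvd_mult_iff)
  moreover have nd: "\<not> int p dvd x" if x: "x \<in> carrier ?P" "x \<noteq> 0" for x
  proof (rule zdvd_not_zless)
    have "0 \<le> x" "x < int p"
      using x(1) prime_gt_0_nat[OF p] by (simp_all add: carrier_integer_mod_group)
    then show "0 < x" "x < int p" using x(2) by simp_all
  qed
  have "\<not> int p dvd \<chi> z" by (rule nd[OF hom_in_carrier[OF \<chi>(1) zc] z(2)])
  moreover have "\<not> int p dvd \<psi> h" by (rule nd[OF hom_in_carrier[OF \<psi>(1) h(1)] h(2)])
  ultimately show False by simp
qed

section \<open>Minimal numbers of generators\<close>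

lemma min_generators_le_card:
  assumes "S \<subseteq> carrier G" "finite S" "generate G S = carrier G"
  shows "min_generators G \<le> card S"
  unfolding min_generators_def using assms by (intro Least_le) blast

lemma (in group) min_generators_attained:
  assumes "finite (carrier G)"
  obtains S where "S \<subseteq> carrier G" "finite S" "card S = min_generators G" "generate G S = carrier G"
proof -
  let ?P = "\<lambda>n. \<exists>S. S \<subseteq> carrier G \<and> finite S \<and> card S = n \<and> generate G S = carrier G"
  have "generate G (carrier G) = carrier G"
    using generateI[OF subgroup_self] by (metis subset_refl)
  then have "?P (card (carrier G))" using assms by blast
  then have "?P (min_generators G)" unfolding min_generators_def by (rule LeastI)
  then show thesis using that by blast
qed

lemma (in group_hom) min_generators_surj_le:
  assumes fin: "finite (carrier G)" and surj: "h ` carrier G = carrier H"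
  shows "min_generators H \<le> min_generators G"
proof -
  obtain S where S: "S \<subseteq> carrier G" "finite S" "card S = min_generators G" "generate G S = carrier G"
    using G.min_generators_attained[OF fin] by blast
  have "min_generators H \<le> card (h ` S)"
    using S surj by (intro min_generators_le_card) (auto simp: generate_img)
  also have "\<dots> \<le> min_generators G" using S card_image_le by metis
  finally show ?thesis .
qed

lemma (in group) min_generators_iso_le:
  assumes "group K" "finite (carrier G)" "G \<cong> K"
  shows "min_generators K \<le> min_generators G"
proof -
  obtain f where f: "f \<in> hom G K" "f ` carrier G = carrier K"
    using assms(3) by (auto simp: is_iso_def iso_def bij_betw_def)
  interpret group_hom G K f
    using f assms by (simp add: group_hom_def group_hom_axioms_def is_group)
  show ?thesis by (rule min_generators_surj_le[OF assms(2) f(2)])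
qed

lemma (in group) min_generators_eq_0_iff:
  assumes "finite (carrier G)"
  shows "min_generators G = 0 \<longleftrightarrow> carrier G = {\<one>}"
proof
  assume "min_generators G = 0"
  then show "carrier G = {\<one>}"
    using min_generators_attained[OF assms] generate_empty by (metis card_0_eq)
next
  assume "carrier G = {\<one>}"
  then have "min_generators G \<le> card ({} :: 'a set)"
    using min_generators_le_card[of "{}" G] by (simp add: generate_empty)
  then show "min_generators G = 0" by simp
qed

text \<open>
  The maximum with 1 accounts for the cyclic case: there the quotient is trivial and would
  predict no generators. In the noncyclic case the quotient and the group need equally many.
\<close>

lemma (in group) min_generators_mod_exterior_center:
  assumes p: "prime p" and ord: "order G = p ^ n"
  shows "min_generators G =
    (if carrier G = {\<one>} then 0 else max 1 (min_generators (G Mod exterior_center G)))"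
proof (cases "carrier G = {\<one>}")
  case True
  then show ?thesis using min_generators_eq_0_iff by simp
next
  case nontriv: False
  let ?Z = "exterior_center G"
  have fin: "finite (carrier G)" by (rule finite_carrier_of_prime_power_order[OF p ord])
  interpret Z: normal ?Z G by (rule exterior_center_normal)
  interpret Q: group "G Mod ?Z" by (rule Z.factorgroup_is_group)
  interpret q: group_hom G "G Mod ?Z" "(#>) ?Z"
    by (simp add: group_hom_def group_hom_axioms_def Z.r_coset_hom_Mod is_group Q.is_group)
  have surj: "(#>) ?Z ` carrier G = carrier (G Mod ?Z)" by (simp add: carrier_FactGroup)
  have finQ: "finite (carrier (G Mod ?Z))" using fin by (simp add: carrier_FactGroup)
  have pos: "min_generators G \<ge> 1"
    using min_generators_eq_0_iff[OF fin] nontriv by linarith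
  show ?thesis
  proof (cases "\<exists>a \<in> carrier G. generate G {a} = carrier G")
    case True
    then obtain a where a: "a \<in> carrier G" "generate G {a} = carrier G" by blast
    have "min_generators G \<le> card {a}" using a by (intro min_generators_le_card) auto
    moreover have "?Z #> g = ?Z" if "g \<in> carrier G" for g
      using that exterior_center_cyclic[OF a] coset_join2[OF _ Z.subgroup_axioms] by simp
    then have "carrier (G Mod ?Z) = {\<one>\<^bsub>G Mod ?Z\<^esub>}"
      using one_closed by (auto simp: carrier_FactGroup)
    then have "min_generators (G Mod ?Z) = 0" using Q.min_generators_eq_0_iff[OF finQ] by simp
    ultimately show ?thesis using nontriv pos by simp
  next
    case False
    obtain T where T: "T \<subseteq> carrier (G Mod ?Z)" "finite T" "card T = min_generators (G Mod ?Z)"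
        "generate (G Mod ?Z) T = carrier (G Mod ?Z)"
      using Q.min_generators_attained[OF finQ] by blast
    \<comment> \<open>One representative per coset keeps the number of generators.\<close>
    obtain S where S: "S \<subseteq> carrier G" "T = (#>) ?Z ` S" "inj_on ((#>) ?Z) S"
      using T(1) surj by (metis subset_image_inj)
    have "generate G S = carrier G"
      using False generate_lift_mod_exterior_center[OF p ord _ S(1)] T(4) S(2) by blast
    moreover have "finite S" using S fin finite_subset by blast
    ultimately have "min_generators G \<le> card S" using S by (intro min_generators_le_card)
    also have "\<dots> = min_generators (G Mod ?Z)" using S T card_image by metis
    finally show ?thesis using q.min_generators_surj_le[OF fin surj] nontriv pos by simp
  qed
qed

theorem theorem3p12:
  fixes p :: nat
    and G :: "('a, 'm) monoid_scheme"
    and H :: "('b, 'n) monoid_scheme"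
  assumes "prime p"
    and "finite_p_group p G"
    and "finite_p_group p H"
    and "carrier G = {\<one>\<^bsub>G\<^esub>} \<longleftrightarrow> carrier H = {\<one>\<^bsub>H\<^esub>}"
  shows "(G Mod exterior_center G \<cong> H Mod exterior_center H
            \<longrightarrow> min_generators G = min_generators H)
       \<and> (exterior_isoclinic G H \<longrightarrow> min_generators G = min_generators H)"
proof -
  let ?Q = "G Mod exterior_center G" and ?R = "H Mod exterior_center H"
  obtain m where G: "group G" "finite (carrier G)" "order G = p ^ m"
    using assms(2) unfolding finite_p_group_def by blast
  obtain n where H: "group H" "finite (carrier H)" "order H = p ^ n"
    using assms(3) unfolding finite_p_group_def by blast
  have Q: "group ?Q" "finite (carrier ?Q)"
    using normal.factorgroup_is_group[OF group.exterior_center_normal[OF G(1)]] G(2)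
    by (simp_all add: carrier_FactGroup)
  have R: "group ?R" "finite (carrier ?R)"
    using normal.factorgroup_is_group[OF group.exterior_center_normal[OF H(1)]] H(2)
    by (simp_all add: carrier_FactGroup)
  have main: "min_generators G = min_generators H" if iso: "?Q \<cong> ?R"
  proof -
    have "?R \<cong> ?Q" by (rule group.iso_sym[OF Q(1) iso])
    then have "min_generators ?Q = min_generators ?R"
      using group.min_generators_iso_le[OF Q(1) R(1) Q(2) iso]
        group.min_generators_iso_le[OF R(1) Q(1) R(2)] by simp
    then show ?thesis
      using group.min_generators_mod_exterior_center[OF G(1) assms(1) G(3)]
        group.min_generators_mod_exterior_center[OF H(1) assms(1) H(3)] assms(4) by simp
  qed
  moreover have "?Q \<cong> ?R" if "exterior_isoclinic G H"
    using that by (auto simp: exterior_isoclinic_def is_iso_def)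
  ultimately show ?thesis by blast
qed

end
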